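(* For every integer $q\ge 1$, the formal power series $g(z)=\sum_{n=0}^{\infty}b_nz^n$ satisfies the differential equation $$z^2(1+z^q)\,g'(z)-(1+z^q)\bigl(1-z-(q-1)z^q\bigr)\,g(z)+1-(q-1)z^q=0,\qquad g(0)=1.$$
   Context: $S_n$ is the set of all permutations of $[n]=\{1,2,\ldots,n\}$ (with $S_0$ consisting of the single empty permutation). For a fixed integer $q\ge 1$, an adjacent $q$-cycle (A$q$C) of a permutation $\pi\in S_n$ is a cycle of length $q$ in the disjoint cycle decomposition of $\pi$ of the form $(a,a+1,a+2,\ldots,a+q-1)$, i.e. $\pi(a+i)=a+i+1$ for $0\le i\le q-2$ and $\pi(a+q-1)=a$ (for $q=1$ this is a fixed point). For fixed $q$, $b_n$ denotes the number of permutations in $S_n$ having no A$q$C's (so $b_0=1$ for every $q\ge1$). Here $g'$ is the formal derivative. *)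

theory Defs
  imports
    "HOL-Combinatorics.Permutations"
    "HOL-Computational_Algebra.Formal_Power_Series"
begin

(* (a, a+1, ..., a+q-1) is a cycle of the permutation p of {1..n}. The bounds on a matter:
   "p permutes {1..n}" fixes everything outside {1..n}, and those points are not cycles in S_n.
   "i + 1 < q" and "a + q \<le> n + 1" are "i \<le> q - 2" and "a + q - 1 \<le> n" without truncated
   subtraction. *)
definition is_adjacent_cycle :: "nat \<Rightarrow> nat \<Rightarrow> (nat \<Rightarrow> nat) \<Rightarrow> nat \<Rightarrow> bool" where
  "is_adjacent_cycle q n p a \<longleftrightarrow>
     1 \<le> a \<and> a + q \<le> n + 1 \<and>
     (\<forall>i. i + 1 < q \<longrightarrow> p (a + i) = a + i + 1) \<and> p (a + q - 1) = a"

definition num_no_adjacent_cycle :: "nat \<Rightarrow> nat \<Rightarrow> nat" where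
  "num_no_adjacent_cycle q n =
     card {p. p permutes {1..n} \<and> (\<nexists>a. is_adjacent_cycle q n p a)}"

definition no_adjacent_cycle_gf :: "nat \<Rightarrow> int fps" where
  "no_adjacent_cycle_gf q = Abs_fps (\<lambda>n. int (num_no_adjacent_cycle q n))"

end

theory Submission
  imports Defs
begin

text \<open>
  Write \<open>w = z ^ q\<close> and \<open>b n\<close> for the number of permutations of \<open>{1..n}\<close> without adjacent
  \<open>q\<close>-cycles. Inclusion-exclusion over the set \<open>S\<close> of starting points of marked adjacent cycles
  reduces \<open>b n\<close> to counting permutations that have an adjacent cycle at every point of \<open>S\<close>. Two
  distinct adjacent cycles never overlap, so only sets whose elements are at least \<open>q\<close> apart
  contribute. If such a set has \<open>j\<close> elements, the permutation is prescribed on \<open>q * j\<close> points and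
  is arbitrary on the others, which gives \<open>(n - q * j)!\<close> choices. Contracting each block of \<open>q\<close>
  points to one point shows that there are \<open>n - (q - 1) * j choose j\<close> such sets. Hence
  (\<open>num_no_adjacent_cycle_eq_sum\<close>)
  \<open>b n = (\<Sum>j. (-1) ^ j * (n - (q - 1) * j choose j) * (n - q * j)!)\<close>.

  For \<open>q * j \<le> n\<close> the \<open>j\<close>-th summand is \<open>t n j = (-1) ^ j * (n - (q - 1) * j)! / j!\<close>. With
  \<open>N = n - (q - 1) * j\<close>, the identity \<open>N = n - (q - 1) * j\<close> multiplied by
  \<open>(-1) ^ j * (N - 1)! / j!\<close> says \<open>t n j = n * t (n - 1) j + (q - 1) * t (n - q) (j - 1)\<close>, without
  the last summand for \<open>j = 0\<close>. The only exception is \<open>q * j = n\<close>, where \<open>t (n - 1) j\<close> is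
  \<open>0\<close> instead of the quotient of factorials. Summing over \<open>j\<close> gives, for \<open>n \<ge> 1\<close> (\<open>num_no_adjacent_cycle_Suc\<close>),
  \<open>b n = n * b (n - 1) + (q - 1) * b (n - q) + (if q dvd n then (-1) ^ (n div q) * q else 0)\<close>.

  In terms of \<open>g\<close>, this recurrence is
  \<open>z ^ 2 * g' - (1 - z - (q - 1) * w) * g = (q - 1) - q / (1 + w)\<close>, because the exceptional terms are
  the coefficients of \<open>q / (1 + w)\<close>. Multiplication by \<open>1 + w\<close> yields the differential equation.
\<close>

section \<open>Separated sets of starting points\<close>

text \<open>
  These are the sets of starting points of pairwise disjoint blocks of \<open>q\<close> consecutive points of
  \<open>{1..n}\<close>.
\<close>
definition separated :: "nat \<Rightarrow> nat \<Rightarrow> nat set \<Rightarrow> bool" where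
  "separated q n S \<longleftrightarrow> (\<forall>a\<in>S. 1 \<le> a \<and> a + q \<le> n + 1) \<and> (\<forall>a\<in>S. \<forall>b\<in>S. a < b \<longrightarrow> a + q \<le> b)"

lemma separated_subset: "q \<ge> 1 \<Longrightarrow> separated q n S \<Longrightarrow> S \<subseteq> {1..n}"
  unfolding separated_def by fastforce

lemma separated_empty [simp]: "separated q n {}"
  by (simp add: separated_def)

lemma finite_separated: "q \<ge> 1 \<Longrightarrow> finite {S. separated q n S \<and> P S}"
  by (rule finite_subset[of _ "Pow {1..n}"]) (use separated_subset in blast, simp)

text \<open>
  The last possible starting point is \<open>n + 1 - q\<close>, whose block ends at \<open>n\<close>. If it is not used, no
  block reaches \<open>n\<close>, and if it is used, the other blocks lie in \<open>{1..n - q}\<close>. The next two lemmas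
  thus give the recursion behind \<open>card_separated\<close>.
\<close>
lemma separated_without_last_iff:
  assumes "q \<ge> 1" "q \<le> n" "n + 1 - q \<notin> S"
  shows "separated q n S \<longleftrightarrow> separated q (n - 1) S"
proof
  assume *: "separated q n S"
  have "a + q \<le> n - 1 + 1" if "a \<in> S" for a
  proof -
    have "a + q \<le> n + 1" "a \<noteq> n + 1 - q" using * that assms by (auto simp: separated_def)
    with assms show ?thesis by linarith
  qed
  with * show "separated q (n - 1) S" by (auto simp: separated_def)
next
  assume "separated q (n - 1) S"
  with assms show "separated q n S" by (fastforce simp: separated_def)
qed

lemma separated_with_last_iff:
  assumes "q \<ge> 1" "q \<le> n" "n + 1 - q \<notin> S"
  shows "separated q n (insert (n + 1 - q) S) \<longleftrightarrow> separated q (n - q) S"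
proof
  assume *: "separated q n (insert (n + 1 - q) S)"
  have "a + q \<le> n - q + 1" if "a \<in> S" for a
  proof -
    have "a + q \<le> n + 1" using * that by (auto simp: separated_def)
    moreover have "a \<noteq> n + 1 - q" using that assms by auto
    ultimately have "a < n + 1 - q" using assms by linarith
    hence "a + q \<le> n + 1 - q" using * that by (auto simp: separated_def)
    thus ?thesis using assms by linarith
  qed
  with * show "separated q (n - q) S" by (auto simp: separated_def)
next
  assume *: "separated q (n - q) S"
  hence 1: "1 \<le> a \<and> a + q \<le> n + 1 - q" if "a \<in> S" for a
    using that assms(2) by (auto simp: separated_def)
  have 2: "a + q \<le> b" if "a \<in> S" "b \<in> S" "a < b" for a b
    using * that by (auto simp: separated_def)
  have 3: "a + q \<le> n + 1" if "a \<in> S" for a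
    using 1[OF that] by linarith
  have 4: "\<not> n + 1 - q < a" if "a \<in> S" for a
    using 1[OF that] by linarith
  have 5: "1 \<le> n + 1 - q" "n + 1 - q + q \<le> n + 1" using assms by linarith+
  show "separated q n (insert (n + 1 - q) S)"
    unfolding separated_def using 1 2 3 4 5 by (auto simp del: One_nat_def)
qed

text \<open>
  Splitting by whether a block ends at \<open>n\<close> turns into Pascal's rule for the binomial coefficient.
  If \<open>j\<close> blocks do not fit into \<open>n\<close> points, then \<open>n - (q - 1) * j < j\<close>, also with
  truncated subtraction, and both sides are \<open>0\<close>.
\<close>
lemma card_separated:
  assumes q: "q \<ge> 1"
  shows "card {S. separated q n S \<and> card S = j} = (n - (q - 1) * j) choose j"
proof (induction n arbitrary: j rule: less_induct)
  case (less n)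
  have fin: "finite S" if "separated q k S" for k S
    using separated_subset[OF q that] finite_subset by blast
  show ?case
  proof (cases j)
    case 0
    have "{S. separated q n S \<and> card S = 0} = {{}}"
      using fin by auto
    thus ?thesis using 0 by simp
  next
    case (Suc i)
    show ?thesis
    proof (cases "q \<le> n")
      case False
      hence "separated q n S \<longleftrightarrow> S = {}" for S
        by (fastforce simp: separated_def)
      hence "{S. separated q n S \<and> card S = j} = {}"
        using Suc by auto
      moreover have "n - (q - 1) * j < j"
        using False Suc q by (cases q) auto
      ultimately show ?thesis by (simp only: binomial_eq_0 card.empty)
    next
      case True
      let ?e = "n + 1 - q"
      define A where "A = {S. separated q (n - 1) S \<and> card S = j}"
      define B where "B = {S. separated q (n - q) S \<and> card S = i}"
      have notinA: "?e \<notin> S" if "separated q (n - 1) S" for S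
        using that True q by (auto simp: separated_def)
      have notinB: "?e \<notin> S" if "separated q (n - q) S" for S
        using that True q by (auto simp: separated_def)
      have eq: "{S. separated q n S \<and> card S = j} = A \<union> insert ?e ` B" (is "?L = ?R")
      proof (intro equalityI subsetI)
        fix S assume S: "S \<in> ?L"
        show "S \<in> ?R"
        proof (cases "?e \<in> S")
          case False
          thus ?thesis using S separated_without_last_iff[OF q True False] by (auto simp: A_def)
        next
          case eS: True
          define T where "T = S - {?e}"
          have T: "S = insert ?e T" "?e \<notin> T" using eS by (auto simp: T_def)
          have "separated q (n - q) T"
            using S separated_with_last_iff[OF q True T(2)] T(1) by simp
          moreover from this have "card T = i"
            using S T fin Suc by simp
          ultimately show ?thesis using T by (auto simp: B_def)
        qed
      next
        fix S assume "S \<in> ?R"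
        thus "S \<in> ?L"
        proof
          assume "S \<in> A"
          thus ?thesis using separated_without_last_iff[OF q True notinA] by (auto simp: A_def)
        next
          assume "S \<in> insert ?e ` B"
          then obtain T where T: "S = insert ?e T" "T \<in> B" by auto
          hence "?e \<notin> T" using notinB by (auto simp: B_def)
          thus ?thesis using T separated_with_last_iff[OF q True] Suc fin
            by (auto simp: B_def)
        qed
      qed
      have "card ?L = card A + card (insert ?e ` B)"
        unfolding eq
      proof (rule card_Un_disjoint)
        show "A \<inter> insert ?e ` B = {}" using notinA by (auto simp: A_def)
      qed (use finite_separated[OF q] in \<open>auto simp: A_def B_def\<close>)
      also have "card (insert ?e ` B) = card B"
      proof (rule card_image, rule inj_onI)
        fix S T assume "S \<in> B" "T \<in> B" "insert ?e S = insert ?e T"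
        thus "S = T" using notinB[of S] notinB[of T] unfolding B_def
          by (metis (no_types, lifting) insert_ident mem_Collect_eq)
      qed
      also have "card A = (n - 1 - (q - 1) * j) choose j"
        unfolding A_def using True q by (intro less.IH) auto
      also have "card B = (n - q - (q - 1) * i) choose i"
        unfolding B_def using True q by (intro less.IH) auto
      also have "n - q - (q - 1) * i = n - 1 - (q - 1) * j"
        using Suc q by (cases q) auto
      also have "((n - 1 - (q - 1) * j) choose j) + ((n - 1 - (q - 1) * j) choose i)
          = (n - (q - 1) * j) choose j"
      proof (cases "(q - 1) * j < n")
        case True
        hence "n - (q - 1) * j = Suc (n - 1 - (q - 1) * j)" by linarith
        thus ?thesis using Suc by simp
      next
        case False
        \<comment> \<open>All upper indices are truncated to \<open>0\<close>, where Pascal's rule fails for \<open>i = 0\<close>; but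
          \<open>i = 0\<close> would give \<open>n < q\<close>.\<close>
        have "i \<noteq> 0" using False \<open>q \<le> n\<close> q Suc by (intro notI) auto
        thus ?thesis using False Suc by (cases i) auto
      qed
      finally show ?thesis .
    qed
  qed
qed

section \<open>Permutations with prescribed adjacent cycles\<close>

definition blocks :: "nat \<Rightarrow> nat set \<Rightarrow> nat set" where
  "blocks q S = (\<Union>a\<in>S. {a..<a + q})"

lemma blocks_memI: "a \<in> S \<Longrightarrow> i < q \<Longrightarrow> a + i \<in> blocks q S"
  unfolding blocks_def by (rule UN_I[of a]) simp_all

text \<open>
  This is the product of the cycles \<open>(a, a + 1, ..., a + q - 1)\<close> for \<open>a \<in> S\<close>. A point \<open>x\<close> is the
  last one of its block when \<open>x + 1 - q\<close> is a starting point; the test \<open>q \<le> x + 1\<close> keeps the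
  subtraction from being truncated.
\<close>
definition block_rotation :: "nat \<Rightarrow> nat set \<Rightarrow> nat \<Rightarrow> nat" where
  "block_rotation q S x =
     (if x \<notin> blocks q S then x
      else if q \<le> x + 1 \<and> x + 1 - q \<in> S then x + 1 - q else x + 1)"

lemma card_blocks:
  assumes "finite S" "separated q n S"
  shows "card (blocks q S) = q * card S"
proof -
  have "{a..<a + q} \<inter> {b..<b + q} = {}" if "a \<in> S" "b \<in> S" "a \<noteq> b" for a b
  proof -
    have "a + q \<le> b \<or> b + q \<le> a"
      using assms that unfolding separated_def by (meson linorder_neqE_nat)
    thus ?thesis by auto
  qed
  hence "card (blocks q S) = (\<Sum>a\<in>S. card {a..<a + q})"
    unfolding blocks_def using assms by (intro card_UN_disjoint) auto
  thus ?thesis by simp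
qed

lemma blocks_subset: "separated q n S \<Longrightarrow> blocks q S \<subseteq> {1..n}"
  unfolding separated_def blocks_def by fastforce

lemma block_rotation_apply:
  assumes S: "separated q n S" and a: "a \<in> S" and i: "i < q"
  shows "block_rotation q S (a + i) = (if i + 1 = q then a else a + i + 1)"
proof -
  have mem: "a + i \<in> blocks q S" using a i by (rule blocks_memI)
  have "i + 1 = q" if "q \<le> a + i + 1" "a + i + 1 - q \<in> S"
  proof (rule ccontr)
    assume "i + 1 \<noteq> q"
    hence "a + i + 1 - q < a" using i that by linarith
    hence "a + i + 1 - q + q \<le> a" using S a that(2) unfolding separated_def by blast
    thus False using that i by linarith
  qed
  thus ?thesis using mem a by (auto simp: block_rotation_def)
qed

lemma block_rotation_permutes:
  assumes q: "q \<ge> 1" and S: "separated q n S"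
  shows "block_rotation q S permutes blocks q S"
proof (rule bij_imp_permutes)
  have fin: "finite (blocks q S)" using blocks_subset[OF S] finite_subset by blast
  have "blocks q S \<subseteq> block_rotation q S ` blocks q S"
  proof
    fix y assume "y \<in> blocks q S"
    then obtain a i where y: "a \<in> S" "y = a + i" "i < q"
      unfolding blocks_def by (auto simp: le_iff_add)
    \<comment> \<open>the preimage of \<open>a + i\<close> is the cyclic predecessor \<open>a + k\<close> in its block\<close>
    define k where "k = (if i = 0 then q - 1 else i - 1)"
    have k: "k < q" using y by (auto simp: k_def)
    have "block_rotation q S (a + k) = y"
      using block_rotation_apply[OF S y(1) k] y q by (auto simp: k_def)
    moreover have "a + k \<in> blocks q S" using y(1) k by (rule blocks_memI)
    ultimately show "y \<in> block_rotation q S ` blocks q S" by blast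
  qed
  moreover have "card (block_rotation q S ` blocks q S) \<le> card (blocks q S)"
    by (rule card_image_le[OF fin])
  ultimately have eq: "block_rotation q S ` blocks q S = blocks q S"
    using fin by (metis card_seteq finite_imageI)
  thus "bij_betw (block_rotation q S) (blocks q S) (blocks q S)"
    using fin by (simp add: bij_betw_def eq_card_imp_inj_on)
qed (simp add: block_rotation_def)

text \<open>
  If the cycle at \<open>b\<close> started inside the one at \<open>a < b\<close>, then the last point \<open>a + q - 1\<close> of the
  cycle at \<open>a\<close> would be a point of the cycle at \<open>b\<close> before its last one. It would be sent to
  \<open>a + q\<close> rather than back to \<open>a\<close>.
\<close>
lemma adjacent_cycles_separated:
  assumes "q \<ge> 1"
  shows "separated q n {a. is_adjacent_cycle q n p a}"
proof -
  have "a + q \<le> b" if a: "is_adjacent_cycle q n p a" and b: "is_adjacent_cycle q n p b" and "a < b" for a b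
  proof (rule ccontr)
    assume "\<not> a + q \<le> b"
    define i where "i = a + q - 1 - b"
    have i: "b + i = a + q - 1" "i + 1 < q" 
      using \<open>\<not> a + q \<le> b\<close> \<open>a < b\<close> unfolding i_def by linarith+
    have "p (a + q - 1) = a" using a by (simp add: is_adjacent_cycle_def)
    moreover have "p (b + i) = b + i + 1" using b i(2) by (simp add: is_adjacent_cycle_def)
    ultimately show False using i(1) \<open>a < b\<close> by simp
  qed
  thus ?thesis unfolding separated_def by (auto simp: is_adjacent_cycle_def)
qed

lemma separated_mono: "separated q n T \<Longrightarrow> S \<subseteq> T \<Longrightarrow> separated q n S"
  unfolding separated_def by blast

lemma adjacent_cycles_iff_block_rotation:
  assumes q: "q \<ge> 1" and S: "separated q n S"
  shows "(\<forall>a\<in>S. is_adjacent_cycle q n p a) \<longleftrightarrow> (\<forall>x\<in>blocks q S. p x = block_rotation q S x)"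
proof
  assume *: "\<forall>a\<in>S. is_adjacent_cycle q n p a"
  show "\<forall>x\<in>blocks q S. p x = block_rotation q S x"
  proof
    fix x assume "x \<in> blocks q S"
    then obtain a i where x: "a \<in> S" "x = a + i" "i < q"
      unfolding blocks_def by (auto simp: le_iff_add)
    have "is_adjacent_cycle q n p a" using * x by blast
    hence "p x = (if i + 1 = q then a else a + i + 1)"
      using x by (auto simp: is_adjacent_cycle_def)
    thus "p x = block_rotation q S x"
      using block_rotation_apply[OF S x(1,3)] x(2) by simp
  qed
next
  assume *: "\<forall>x\<in>blocks q S. p x = block_rotation q S x"
  show "\<forall>a\<in>S. is_adjacent_cycle q n p a"
  proof
    fix a assume a: "a \<in> S"
    have p: "p (a + i) = (if i + 1 = q then a else a + i + 1)" if "i < q" for i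
    proof -
      have "a + i \<in> blocks q S" using a that by (rule blocks_memI)
      thus ?thesis using * block_rotation_apply[OF S a that] by simp
    qed
    show "is_adjacent_cycle q n p a"
      using S a p[of "q - 1"] p q by (auto simp: is_adjacent_cycle_def separated_def)
  qed
qed

text \<open>
  Composition with \<open>s\<close> is a bijection from the permutations of \<open>A - U\<close> onto the permutations of \<open>A\<close>
  that agree with \<open>s\<close> on \<open>U\<close>.
\<close>
lemma card_permutes_extending:
  assumes s: "s permutes U" and U: "U \<subseteq> A" and A: "finite A"
  shows "card {p. p permutes A \<and> (\<forall>x\<in>U. p x = s x)} = fact (card A - card U)"
proof -
  have sA: "s permutes A" using permutes_subset[OF s U] .
  have eq: "{p. p permutes A \<and> (\<forall>x\<in>U. p x = s x)} = (\<lambda>r. s \<circ> r) ` {r. r permutes A - U}"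
  proof (intro equalityI subsetI)
    fix p assume "p \<in> {p. p permutes A \<and> (\<forall>x\<in>U. p x = s x)}"
    hence p: "p permutes A" "\<And>x. x \<in> U \<Longrightarrow> p x = s x" by auto
    have "inv s \<circ> p permutes A - U"
    proof (rule permutes_superset)
      show "inv s \<circ> p permutes A" by (intro permutes_compose p permutes_inv sA)
      show "(inv s \<circ> p) x = x" if "x \<in> A - (A - U)" for x
        using that p(2)[of x] permutes_inverses(2)[OF s] by simp
    qed
    moreover have "p = s \<circ> (inv s \<circ> p)"
      by (simp add: fun_eq_iff permutes_inverses(1)[OF s])
    ultimately show "p \<in> (\<lambda>r. s \<circ> r) ` {r. r permutes A - U}" by blast
  next
    fix p assume "p \<in> (\<lambda>r. s \<circ> r) ` {r. r permutes A - U}"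
    then obtain r where r: "p = s \<circ> r" "r permutes A - U" by auto
    have "r permutes A" using permutes_subset[OF r(2)] by blast
    hence "p permutes A" unfolding r by (intro permutes_compose sA)
    moreover have "p x = s x" if "x \<in> U" for x
      using permutes_not_in[OF r(2), of x] that r(1) by simp
    ultimately show "p \<in> {p. p permutes A \<and> (\<forall>x\<in>U. p x = s x)}" by simp
  qed
  have "inj_on (\<lambda>r. s \<circ> r) {r. r permutes A - U}"
    using permutes_inj[OF s] by (auto intro!: inj_onI simp: fun_eq_iff inj_eq)
  hence "card {p. p permutes A \<and> (\<forall>x\<in>U. p x = s x)} = card {r. r permutes A - U}"
    unfolding eq by (rule card_image)
  also have "\<dots> = fact (card (A - U))"
    using A by (intro card_permutations) auto
  also have "card (A - U) = card A - card U"
    using A U by (intro card_Diff_subset) (auto intro: finite_subset)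
  finally show ?thesis .
qed

lemma card_prescribed_adjacent_cycles:
  assumes q: "q \<ge> 1"
  shows "card {p. p permutes {1..n} \<and> (\<forall>a\<in>S. is_adjacent_cycle q n p a)}
    = (if separated q n S then fact (n - q * card S) else 0)"
proof (cases "separated q n S")
  case True
  have "finite S" using separated_subset[OF q True] finite_subset by blast
  thus ?thesis
    using True adjacent_cycles_iff_block_rotation[OF q True]
      card_permutes_extending[OF block_rotation_permutes[OF q True] blocks_subset[OF True]]
      card_blocks[OF _ True] by simp
next
  case False
  hence "{p. p permutes {1..n} \<and> (\<forall>a\<in>S. is_adjacent_cycle q n p a)} = {}"
    using separated_mono[OF adjacent_cycles_separated[OF q]] by blast
  thus ?thesis using False by (simp only: card.empty if_False)
qed

section \<open>Inclusion-exclusion\<close>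

definition incl_excl_term :: "nat \<Rightarrow> nat \<Rightarrow> nat \<Rightarrow> int" where
  "incl_excl_term q n j = (-1) ^ j * (int ((n - (q - 1) * j) choose j) * fact (n - q * j))"

text \<open>
  The sum is the expansion of the product of \<open>1 - 1\<close> over the elements of \<open>A\<close>. It detects the
  permutations whose set of adjacent cycles is empty.
\<close>
lemma sum_Pow_neg_one:
  assumes "finite A"
  shows "(\<Sum>S\<in>Pow A. (-1) ^ card S) = (if A = {} then 1 else (0 :: int))"
proof -
  have "(\<Sum>S\<in>Pow A. (-1) ^ card S) = (0 :: int) ^ card A"
    using prod_diff_conv_sum[OF assms, of "\<lambda>_. 1::int" "\<lambda>_. 1"] by simp
  thus ?thesis using assms by (simp add: power_0_left)
qed

lemma num_no_adjacent_cycle_eq_sum: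
  assumes q: "q \<ge> 1"
  shows "int (num_no_adjacent_cycle q n) = (\<Sum>j\<le>n. incl_excl_term q n j)"
proof -
  define P where "P = {p. p permutes {1..n}}"
  define C where "C p = {a. is_adjacent_cycle q n p a}" for p
  have C: "C p \<subseteq> {1..n}" for p
    unfolding C_def by (rule separated_subset[OF q adjacent_cycles_separated[OF q]])
  have finC: "finite (C p)" for p using C finite_subset by blast
  have finP: "finite P" unfolding P_def by (simp add: finite_permutations)
  have "int (num_no_adjacent_cycle q n) = (\<Sum>p\<in>P. if C p = {} then 1 else 0)"
    using finP unfolding num_no_adjacent_cycle_def P_def C_def
    by (simp add: sum.If_cases Int_def)
  also have "\<dots> = (\<Sum>p\<in>P. \<Sum>S\<in>Pow (C p). (-1) ^ card S)"
    by (simp only: sum_Pow_neg_one[OF finC])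
  also have "\<dots> = (\<Sum>p\<in>P. \<Sum>S\<in>Pow {1..n}. if S \<subseteq> C p then (-1) ^ card S else 0)"
    using C by (intro sum.cong refl sum.mono_neutral_cong_left) auto
  also have "\<dots> = (\<Sum>S\<in>Pow {1..n}. \<Sum>p\<in>P. if S \<subseteq> C p then (-1) ^ card S else 0)"
    by (rule sum.swap)
  also have "\<dots> = (\<Sum>S\<in>Pow {1..n}. (-1) ^ card S * int (card {p \<in> P. S \<subseteq> C p}))"
    using finP by (intro sum.cong refl) (simp add: sum.If_cases Int_def)
  also have "\<dots> = (\<Sum>S\<in>Pow {1..n}. if separated q n S then (-1) ^ card S * fact (n - q * card S) else 0)"
  proof (intro sum.cong refl)
    fix S
    have "{p \<in> P. S \<subseteq> C p} = {p. p permutes {1..n} \<and> (\<forall>a\<in>S. is_adjacent_cycle q n p a)}"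
      by (auto simp: P_def C_def)
    thus "(-1) ^ card S * int (card {p \<in> P. S \<subseteq> C p})
      = (if separated q n S then (-1) ^ card S * fact (n - q * card S) else 0)"
      using card_prescribed_adjacent_cycles[OF q, of n S] by simp
  qed
  also have "\<dots> = (\<Sum>S | separated q n S. (-1) ^ card S * fact (n - q * card S))"
    using separated_subset[OF q] by (intro sum.mono_neutral_cong_right) auto
  also have "\<dots> = (\<Sum>j\<le>n. \<Sum>S | S \<in> {S. separated q n S} \<and> card S = j. (-1) ^ card S * fact (n - q * card S))"
  proof (rule sum.group[symmetric])
    show "finite {S. separated q n S}" using finite_separated[OF q, of n "\<lambda>_. True"] by simp
    show "card ` {S. separated q n S} \<subseteq> {..n}"
      using separated_subset[OF q] card_mono[of "{1..n}"] by fastforce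
  qed simp
  also have "\<dots> = (\<Sum>j\<le>n. incl_excl_term q n j)"
  proof (intro sum.cong refl)
    fix j
    have "(\<Sum>S | S \<in> {S. separated q n S} \<and> card S = j. (-1) ^ card S * fact (n - q * card S))
      = (\<Sum>S | separated q n S \<and> card S = j. (-1) ^ j * (fact (n - q * j) :: int))"
      by (intro sum.cong) auto
    thus "(\<Sum>S | S \<in> {S. separated q n S} \<and> card S = j. (-1) ^ card S * fact (n - q * card S))
      = incl_excl_term q n j"
      by (simp add: card_separated[OF q] incl_excl_term_def)
  qed
  finally show ?thesis .
qed

section \<open>The recurrence\<close>

lemma incl_excl_term_eq_0:
  assumes "q \<ge> 1" "n < q * j"
  shows "incl_excl_term q n j = 0"
proof -
  have "j > 0" using assms by (cases j) auto
  hence "n - (q - 1) * j < j" using assms by (cases q) auto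
  thus ?thesis by (simp add: incl_excl_term_def binomial_eq_0)
qed

text \<open>
  Clearing the denominator of \<open>(-1) ^ j * (n - (q - 1) * j)! / j!\<close> keeps the computation in the
  integers.
\<close>
lemma fact_times_incl_excl_term:
  assumes "q \<ge> 1" "q * j \<le> n"
  shows "fact j * incl_excl_term q n j = (-1) ^ j * fact (n - (q - 1) * j)"
proof -
  have le: "j \<le> n - (q - 1) * j" and eq: "n - (q - 1) * j - j = n - q * j"
    using assms by (cases q; simp)+
  have "(fact j * fact (n - q * j) * int ((n - (q - 1) * j) choose j) :: int) = fact (n - (q - 1) * j)"
    using binomial_fact_lemma[OF le] unfolding eq by (metis of_nat_fact of_nat_mult)
  thus ?thesis unfolding incl_excl_term_def by (simp add: mult_ac)
qed

text \<open>
  After multiplication by \<open>(Suc i)!\<close> all terms are multiples of \<open>N!\<close> for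
  \<open>N = m - (q - 1) * Suc i\<close>, and the claim becomes \<open>N + 1 = Suc m - (q - 1) * Suc i\<close>. When
  \<open>q * Suc i = Suc m\<close>, the term for \<open>m\<close> vanishes because \<open>Suc i\<close> blocks do not fit into \<open>m\<close>
  points; then \<open>N = i\<close>, and the last summand replaces
  \<open>Suc m * (-1) ^ Suc i * N! / (Suc i)! = (-1) ^ Suc i * q\<close>.
\<close>
lemma incl_excl_term_Suc:
  assumes q: "q \<ge> 1"
  shows "incl_excl_term q (Suc m) (Suc i) =
     int (Suc m) * incl_excl_term q m (Suc i)
     + (if q \<le> Suc m then (int q - 1) * incl_excl_term q (Suc m - q) i else 0)
     + (if q * Suc i = Suc m then (-1) ^ Suc i * int q else 0)"
proof (cases "q * Suc i \<le> Suc m")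
  case False
  have "\<not> q \<le> Suc m \<or> Suc m - q < q * i" using False by auto
  thus ?thesis using False q by (auto simp: incl_excl_term_eq_0)
next
  case True
  have qm: "q \<le> Suc m" and qi: "q * i \<le> Suc m - q" using True by auto
  define N where "N = m - (q - 1) * Suc i"
  have "(q - 1) * Suc i + Suc i \<le> Suc m" using True q by (cases q) auto
  hence N: "Suc m - (q - 1) * Suc i = Suc N" "int N = int m - (int q - 1) * (int i + 1)"
    "Suc m - q - (q - 1) * i = N"
    using q unfolding N_def by (cases q; auto simp: of_nat_diff algebra_simps)+
  have 1: "fact (Suc i) * incl_excl_term q (Suc m) (Suc i) = (-1) ^ Suc i * ((int N + 1) * fact N)"
    using fact_times_incl_excl_term[OF q True] unfolding N(1) by (simp add: algebra_simps)
  have 2: "fact i * incl_excl_term q (Suc m - q) i = (-1) ^ i * fact N"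
    using fact_times_incl_excl_term[OF q qi] unfolding N(3) .
  have "fact (Suc i) * incl_excl_term q (Suc m) (Suc i) = fact (Suc i) *
     (int (Suc m) * incl_excl_term q m (Suc i)
     + (int q - 1) * incl_excl_term q (Suc m - q) i
     + (if q * Suc i = Suc m then (-1) ^ Suc i * int q else 0))" (is "_ = _ * ?R")
  proof (cases "q * Suc i = Suc m")
    case False
    hence "fact (Suc i) * incl_excl_term q m (Suc i) = (-1) ^ Suc i * fact N"
      using fact_times_incl_excl_term[OF q, of "Suc i" m] True unfolding N_def by simp
    hence "fact (Suc i) * ?R = int (Suc m) * ((-1) ^ Suc i * fact N)
       + (int q - 1) * (int i + 1) * ((-1) ^ i * fact N)"
      using False unfolding 2[symmetric] by (simp add: algebra_simps)
    also have "\<dots> = (-1) ^ Suc i * ((int N + 1) * fact N)"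
      unfolding N(2) by (simp add: algebra_simps)
    finally show ?thesis using 1 by simp
  next
    case eq: True
    have "N = i" using eq N(1) q by (cases q) auto
    have z: "incl_excl_term q m (Suc i) = 0" using eq q by (intro incl_excl_term_eq_0) auto
    have "fact (Suc i) * ?R = (int q - 1) * (int i + 1) * ((-1) ^ i * fact N)
        + (int i + 1) * fact N * ((-1) ^ Suc i * int q)"
      using eq \<open>N = i\<close> unfolding 2[symmetric] z by (simp add: algebra_simps)
    also have "\<dots> = (-1) ^ Suc i * ((int N + 1) * fact N)"
      unfolding \<open>N = i\<close> by (simp add: algebra_simps)
    finally show ?thesis using 1 by simp
  qed
  thus ?thesis using qm by simp
qed

lemma num_no_adjacent_cycle_0: "q \<ge> 1 \<Longrightarrow> num_no_adjacent_cycle q 0 = 1"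
  using num_no_adjacent_cycle_eq_sum[of q 0] by (simp add: incl_excl_term_def)

lemma num_no_adjacent_cycle_Suc:
  assumes q: "q \<ge> 1"
  shows "int (num_no_adjacent_cycle q (Suc m)) =
     int (Suc m) * int (num_no_adjacent_cycle q m)
     + (if q \<le> Suc m then (int q - 1) * int (num_no_adjacent_cycle q (Suc m - q)) else 0)
     + (if q dvd Suc m then (-1) ^ (Suc m div q) * int q else 0)"
proof -
  let ?t = "incl_excl_term q"
  \<comment> \<open>A common upper bound of summation lets the three sums be compared term by term.\<close>
  have b: "int (num_no_adjacent_cycle q n) = (\<Sum>j\<le>M. ?t n j)" if "n \<le> M" for n M
    unfolding num_no_adjacent_cycle_eq_sum[OF q]
  proof (rule sum.mono_neutral_left)
    show "\<forall>j\<in>{..M} - {..n}. ?t n j = 0"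
    proof
      fix j assume "j \<in> {..M} - {..n}"
      hence "n < 1 * j" by simp
      also have "\<dots> \<le> q * j" using q by (rule mult_right_mono) simp
      finally show "?t n j = 0" using q by (intro incl_excl_term_eq_0)
    qed
  qed (use that in auto)
  have bdry: "(\<Sum>i\<le>m. if q * Suc i = Suc m then (-1) ^ Suc i * int q else 0)
     = (if q dvd Suc m then (-1) ^ (Suc m div q) * int q else 0)"
  proof (cases "q dvd Suc m")
    case True
    define k where "k = Suc m div q"
    have k: "Suc m = q * k" using True by (simp add: k_def)
    then obtain l where l: "k = Suc l" by (cases k) auto
    have "l \<le> m" using k l q by (cases q) auto
    have "(\<Sum>i\<le>m. if q * Suc i = Suc m then (-1) ^ Suc i * int q else 0)
      = (\<Sum>i\<le>m. if i = l then (-1) ^ Suc l * int q else 0)"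
      unfolding k l using q by (intro sum.cong refl) auto
    also have "\<dots> = (-1) ^ k * int q" using \<open>l \<le> m\<close> l by simp
    finally show ?thesis using True by (simp add: k_def)
  next
    case False
    hence "q * Suc i \<noteq> Suc m" for i by (metis dvd_triv_left)
    thus ?thesis using False by simp
  qed
  have "int (num_no_adjacent_cycle q (Suc m)) = ?t (Suc m) 0 + (\<Sum>i\<le>m. ?t (Suc m) (Suc i))"
    unfolding b[OF order.refl] by (rule sum.atMost_Suc_shift)
  also have "?t (Suc m) 0 = int (Suc m) * ?t m 0" by (simp add: incl_excl_term_def)
  also have "(\<Sum>i\<le>m. ?t (Suc m) (Suc i)) =
     int (Suc m) * (\<Sum>i\<le>m. ?t m (Suc i))
     + (if q \<le> Suc m then (int q - 1) * (\<Sum>i\<le>m. ?t (Suc m - q) i) else 0)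
     + (if q dvd Suc m then (-1) ^ (Suc m div q) * int q else 0)"
    unfolding incl_excl_term_Suc[OF q] sum.distrib bdry sum_distrib_left by simp
  also have "(\<Sum>i\<le>m. ?t (Suc m - q) i) = int (num_no_adjacent_cycle q (Suc m - q))"
    using q by (intro b[symmetric]) auto
  also have "(\<Sum>i\<le>m. ?t m (Suc i)) = int (num_no_adjacent_cycle q m) - ?t m 0"
    unfolding b[of m "Suc m", OF le_SucI[OF order.refl]] sum.atMost_Suc_shift by simp
  finally show ?thesis by (simp add: algebra_simps)
qed

section \<open>The differential equation\<close>

text \<open>
  This is \<open>1 / (1 + z ^ q)\<close>, for \<open>q \<ge> 1\<close>, given by its coefficients because the integers are not a field.
\<close>
definition alternating_fps :: "nat \<Rightarrow> int fps" where
  "alternating_fps q = Abs_fps (\<lambda>n. if q dvd n then (-1) ^ (n div q) else 0)"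

lemma alternating_fps_mult:
  assumes "q \<ge> 1"
  shows "(1 + fps_X ^ q) * alternating_fps q = 1"
proof (rule fps_ext)
  fix n
  show "fps_nth ((1 + fps_X ^ q) * alternating_fps q) n = fps_nth 1 n"
  proof (cases "n < q")
    case True
    hence "q dvd n \<longleftrightarrow> n = 0" by (auto dest: dvd_imp_le)
    thus ?thesis using True by (simp add: alternating_fps_def distrib_right fps_X_power_mult_nth)
  next
    case False
    then obtain k where k: "n = q + k" using le_Suc_ex not_less by blast
    show ?thesis using assms
      by (simp add: k alternating_fps_def distrib_right fps_X_power_mult_nth)
  qed
qed

theorem theorem4p1:
  fixes q :: nat
  assumes "q \<ge> 1"
  shows "let z = (fps_X :: int fps); g = no_adjacent_cycle_gf q in
           z ^ 2 * (1 + z ^ q) * fps_deriv g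
             - (1 + z ^ q) * (1 - z - (of_nat q - 1) * z ^ q) * g
             + 1 - (of_nat q - 1) * z ^ q = 0
           \<and> fps_nth g 0 = 1"
proof -
  define z where "z = (fps_X :: int fps)"
  define g where "g = no_adjacent_cycle_gf q"
  define c where "c = fps_const (int q - 1)"
  have c: "c = of_nat q - 1"
    unfolding c_def by (simp add: fps_of_nat[symmetric] fps_const_sub[symmetric] del: fps_const_sub)
  have g_nth: "fps_nth g n = int (num_no_adjacent_cycle q n)" for n
    by (simp add: g_def no_adjacent_cycle_gf_def)
  \<comment> \<open>Coefficientwise, this is the recurrence; the constant \<open>c\<close> corrects the coefficient of
    \<open>z ^ 0\<close>, where the left side has \<open>-1\<close> and \<open>- (c + 1) * alternating_fps q\<close> has \<open>-q\<close>.\<close>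
  have key: "z ^ 2 * fps_deriv g + z * g + c * (z ^ q * g) - g = c - (c + 1) * alternating_fps q"
  proof (rule fps_ext)
    fix n
    have c1: "c + 1 = fps_const (int q)" by (simp add: c_def flip: fps_const_1_eq_1)
    show "fps_nth (z ^ 2 * fps_deriv g + z * g + c * (z ^ q * g) - g) n
       = fps_nth (c - (c + 1) * alternating_fps q) n"
    proof (cases n)
      case 0
      thus ?thesis using assms unfolding c1
        by (simp add: z_def c_def g_nth num_no_adjacent_cycle_0 alternating_fps_def
            fps_X_power_mult_nth)
    next
      case (Suc m)
      have "fps_nth (z ^ 2 * fps_deriv g) n = int m * fps_nth g m"
        unfolding z_def fps_X_power_mult_nth using Suc by (cases m) auto
      moreover have "fps_nth (z * g) n = fps_nth g m"
        by (simp add: z_def Suc)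
      moreover have "fps_nth (c * (z ^ q * g)) n = (if q \<le> n then (int q - 1) * fps_nth g (n - q) else 0)"
        by (simp add: z_def c_def fps_X_power_mult_nth)
      moreover have "fps_nth (c - (c + 1) * alternating_fps q) n
          = - (if q dvd n then (-1) ^ (n div q) * int q else 0)"
        unfolding c1 by (simp add: c_def alternating_fps_def Suc)
      ultimately show ?thesis
        using num_no_adjacent_cycle_Suc[OF assms, of m]
        by (simp only: fps_add_nth fps_sub_nth g_nth Suc of_nat_Suc distrib_right)
    qed
  qed
  have "z ^ 2 * (1 + z ^ q) * fps_deriv g - (1 + z ^ q) * (1 - z - c * z ^ q) * g
     = (1 + z ^ q) * (z ^ 2 * fps_deriv g + z * g + c * (z ^ q * g) - g)"
    by (simp add: algebra_simps)
  also have "\<dots> = (1 + z ^ q) * c - (c + 1) * ((1 + z ^ q) * alternating_fps q)"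
    unfolding key by (simp add: algebra_simps)
  also have "\<dots> = c * z ^ q - 1"
    unfolding z_def alternating_fps_mult[OF assms] by (simp add: algebra_simps)
  finally have "z ^ 2 * (1 + z ^ q) * fps_deriv g - (1 + z ^ q) * (1 - z - c * z ^ q) * g
      + 1 - c * z ^ q = 0" by simp
  moreover have "fps_nth g 0 = 1" using assms by (simp add: g_nth num_no_adjacent_cycle_0)
  ultimately show ?thesis
    unfolding Let_def c z_def g_def by blast
qed

end
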